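(* Let $\varrho(n)$ denote the number of integers $a$ with $1\le a\le n$ for which there exists an integer $x$ with $a^2x\equiv a\pmod n$. Then \[ \liminf_{n\to\infty}\frac{\varrho(n)\log\log n}{n}=e^{-\gamma}, \] where $\gamma$ is Euler's constant.
   Context: An integer $a$ is called regular (mod $n$) if there is an integer $x$ with $a^2x\equiv a \pmod n$; $\varrho(n)$ counts regular integers (mod $n$) in $\{1,\dots,n\}$. Equivalently, $\varrho$ is multiplicative with $\varrho(p^\nu)=p^\nu-p^{\nu-1}+1$ for prime powers. *)

theory Defs
  imports "HOL-Analysis.Analysis" "HOL-Number_Theory.Cong"
begin

definition regular_mod :: "nat \<Rightarrow> int \<Rightarrow> bool" where
  "regular_mod n a \<longleftrightarrow> (\<exists>x::int. [a\<^sup>2 * x = a] (mod int n))"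

definition varrho :: "nat \<Rightarrow> nat" where
  "varrho n = card {a \<in> {1..int n}. regular_mod n a}"

end

theory Submission
  imports Defs "HOL-Number_Theory.Totient" "HOL-Real_Asymp.Real_Asymp"
begin

text \<open>
  Units are regular, so \<open>varrho n\<close> is at least the totient of \<open>n\<close>; and if every prime dividing
  \<open>n\<close> does so to a high power, the two are almost equal, because a regular non-unit must be
  divisible by one of these high prime powers. Both bounds then reduce to Mertens' third theorem,
  \<open>\<Prod>\<^sub>p\<^sub>\<le>\<^sub>m (1 - 1/p) ln m \<longlonglongrightarrow> e\<^sup>-\<^sup>\<gamma>\<close>.

  Mertens' theorem is obtained without Chebyshev's estimates. The Euler product and
  \<open>s \<zeta>(1 + s) \<longlonglongrightarrow> 1\<close> give
  \<open>- \<Sum>\<^sub>p ln (1 - 1/p) p\<^sup>-\<^sup>s = - ln (1 - e\<^sup>-\<^sup>s) + o(1) = \<Sum>\<^sub>n e\<^sup>-\<^sup>s\<^sup>n / n + o(1)\<close> as \<open>s\<close> decreases to \<open>0\<close>.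
  Karamata's Tauberian argument replaces the weight \<open>t = e\<^sup>-\<^sup>s\<^sup>u\<close> on both sides by the
  indicator of \<open>u \<le> 1/s\<close>; with \<open>1/s = ln m\<close> the right-hand side becomes a harmonic number
  \<open>ln (ln m) + \<gamma> + o(1)\<close>.
\<close>

section \<open>The zeta function near 1\<close>

definition rough :: "nat \<Rightarrow> nat set" where
  "rough k = {n. 0 < n \<and> (\<forall>p. prime p \<and> p dvd n \<longrightarrow> k < p)}"

lemma rough_0: "rough 0 = {0<..}"
  by (auto simp: rough_def prime_gt_0_nat)

lemma one_in_rough: "1 \<in> rough k"
  by (auto simp: rough_def)

lemma rough_subset: "rough k \<subseteq> insert 1 {k<..}"
proof
  fix n assume n: "n \<in> rough k"
  show "n \<in> insert 1 {k<..}"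
  proof (cases "n = 1")
    case False
    then obtain p where "prime p" "p dvd n" using prime_factor_nat by blast
    with n have "k < p" "p \<le> n" by (auto simp: rough_def intro: dvd_imp_le)
    then show ?thesis by auto
  qed auto
qed

lemma rough_Suc_not_prime: "\<not> prime (Suc k) \<Longrightarrow> rough (Suc k) = rough k"
  unfolding rough_def using Suc_lessI Suc_lessD by blast

text \<open>The cofactor of a multiple of \<open>Suc k\<close> may again be divisible by
  \<open>Suc k\<close>, so the removed part is an image of \<open>rough k\<close> itself and not of
  \<open>rough (Suc k)\<close>.\<close>

lemma rough_Suc_prime:
  assumes "prime (Suc k)"
  shows "rough k = rough (Suc k) \<union> (*) (Suc k) ` rough k" (is ?eq)
    and "rough (Suc k) \<inter> (*) (Suc k) ` rough k = {}" (is ?disj)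
proof -
  show ?disj using assms by (auto simp: rough_def simp del: mult_Suc)
  show ?eq
  proof (intro equalityI subsetI)
    fix n assume n: "n \<in> rough k"
    show "n \<in> rough (Suc k) \<union> (*) (Suc k) ` rough k"
    proof (cases "Suc k dvd n")
      case True
      then obtain m where m: "n = Suc k * m" by (elim dvdE)
      with n have "m \<in> rough k" by (auto simp: rough_def)
      with m show ?thesis by blast
    next
      case False
      with n have "n \<in> rough (Suc k)" by (auto simp: rough_def) (metis Suc_lessI)
      then show ?thesis by blast
    qed
  next
    fix n assume "n \<in> rough (Suc k) \<union> (*) (Suc k) ` rough k"
    then show "n \<in> rough k"
    proof
      assume "n \<in> (*) (Suc k) ` rough k"
      then obtain m where m: "n = Suc k * m" "m \<in> rough k" by auto
      have "k < p" if "prime p" "p dvd n" for p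
      proof -
        have "p dvd Suc k \<or> p dvd m" using that m by (simp add: prime_dvd_mult_iff del: mult_Suc)
        then show ?thesis
        proof
          assume "p dvd Suc k"
          then have "p = Suc k" using that assms primes_dvd_imp_eq by blast
          then show ?thesis by simp
        qed (use m that in \<open>auto simp: rough_def\<close>)
      qed
      with m show ?thesis by (auto simp: rough_def)
    qed (auto simp: rough_def)
  qed
qed

definition zeta :: "real \<Rightarrow> real" where
  "zeta \<sigma> = (\<Sum>\<^sub>\<infinity>n\<in>{0<..}. real n powr - \<sigma>)"

lemma powr_minus_summable_on:
  assumes "\<sigma> > 1"
  shows "(\<lambda>n. real n powr - \<sigma>) summable_on A"
proof -
  have "summable (\<lambda>n. real n powr - \<sigma>)" using assms by (simp add: summable_real_powr_iff)
  then have "(\<lambda>n. real n powr - \<sigma>) summable_on UNIV"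
    by (intro norm_summable_imp_summable_on) simp
  then show ?thesis by (rule summable_on_subset_banach) auto
qed

text \<open>At a prime \<open>p = Suc k\<close> the removed multiples contribute
  \<open>p powr - \<sigma>\<close> times the current sum, so each sieve step multiplies the sum by
  one Euler factor.\<close>

lemma infsum_rough:
  assumes "\<sigma> > 1"
  shows "(\<Sum>\<^sub>\<infinity>n\<in>rough k. real n powr - \<sigma>) =
           zeta \<sigma> * (\<Prod>i<Suc k. if prime i then 1 - real i powr - \<sigma> else 1)"
proof (induction k)
  case 0
  then show ?case by (simp add: zeta_def rough_0)
next
  case (Suc k)
  let ?f = "\<lambda>n. real n powr - \<sigma>"
  note sm = powr_minus_summable_on[OF assms]
  show ?case
  proof (cases "prime (Suc k)")
    case True
    have "infsum ?f (rough k) = infsum ?f (rough (Suc k)) + infsum ?f ((*) (Suc k) ` rough k)"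
      by (subst rough_Suc_prime(1)[OF True])
         (intro infsum_Un_disjoint sm rough_Suc_prime(2)[OF True])
    also have "infsum ?f ((*) (Suc k) ` rough k) = (\<Sum>\<^sub>\<infinity>n\<in>rough k. ?f (Suc k) * ?f n)"
      by (subst infsum_reindex)
         (auto simp: inj_on_def powr_mult simp del: mult_Suc of_nat_Suc intro!: infsum_cong)
    also have "\<dots> = ?f (Suc k) * infsum ?f (rough k)" by (rule infsum_cmult_right')
    finally have "infsum ?f (rough (Suc k)) = infsum ?f (rough k) * (1 - ?f (Suc k))"
      by (simp add: algebra_simps)
    with True Suc show ?thesis by simp
  next
    case False
    with Suc show ?thesis by (simp add: rough_Suc_not_prime)
  qed
qed

lemma zeta_ge_1: "\<sigma> > 1 \<Longrightarrow> zeta \<sigma> \<ge> 1"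
proof -
  assume s: "\<sigma> > 1"
  have "(\<Sum>\<^sub>\<infinity>n\<in>{1}. real n powr - \<sigma>) \<le> zeta \<sigma>"
    unfolding zeta_def by (intro infsum_mono2 powr_minus_summable_on s) auto
  then show ?thesis by simp
qed

text \<open>Euler's sieve: removing the multiples of all primes up to \<open>k\<close> from the zeta series leaves
  the sum over the \<open>k\<close>-rough numbers, which tends to its first term.\<close>
lemma euler_product:
  assumes "\<sigma> > 1"
  shows "(\<lambda>k. \<Prod>i<k. if prime i then 1 - real i powr - \<sigma> else 1) \<longlonglongrightarrow> 1 / zeta \<sigma>"
proof -
  let ?f = "\<lambda>n. real n powr - \<sigma>"
  note sm = powr_minus_summable_on[OF assms]
  have "summable ?f" using assms by (simp add: summable_real_powr_iff)
  then have 1: "(\<lambda>k. suminf ?f - (\<Sum>i<Suc k. ?f i)) \<longlonglongrightarrow> suminf ?f - suminf ?f"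
    by (intro tendsto_intros LIMSEQ_Suc) (rule summable_LIMSEQ)
  have tail: "infsum ?f {k<..} = suminf ?f - (\<Sum>i<Suc k. ?f i)" for k
  proof -
    have "suminf ?f = infsum ?f UNIV"
      by (rule sums_unique[symmetric], rule has_sum_imp_sums, rule has_sum_infsum, rule sm)
    also have "UNIV = {..<Suc k} \<union> {k<..}" by auto
    also have "infsum ?f ({..<Suc k} \<union> {k<..}) = infsum ?f {..<Suc k} + infsum ?f {k<..}"
      by (intro infsum_Un_disjoint sm) auto
    finally show ?thesis by simp
  qed
  have "(\<lambda>k. infsum ?f (rough k)) \<longlonglongrightarrow> 1"
  proof (rule tendsto_sandwich[OF _ _ tendsto_const])
    show "\<forall>\<^sub>F k in sequentially. 1 \<le> infsum ?f (rough k)"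
    proof (intro always_eventually allI)
      fix k
      have "infsum ?f {1} \<le> infsum ?f (rough k)"
        using one_in_rough by (intro infsum_mono2 sm) auto
      then show "1 \<le> infsum ?f (rough k)" by simp
    qed
    show "\<forall>\<^sub>F k in sequentially. infsum ?f (rough k) \<le> 1 + infsum ?f {k<..}"
    proof (intro eventually_sequentiallyI)
      \<comment> \<open>For \<open>k = 0\<close> the sets \<open>{1}\<close> and
        \<open>{k<..}\<close> overlap.\<close>
      fix k :: nat assume "k \<ge> 1"
      have "infsum ?f (rough k) \<le> infsum ?f ({1} \<union> {k<..})"
        using rough_subset[of k] by (intro infsum_mono2 sm) auto
      also have "\<dots> = infsum ?f {1} + infsum ?f {k<..}"
        using \<open>k \<ge> 1\<close> by (intro infsum_Un_disjoint sm) auto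
      finally show "infsum ?f (rough k) \<le> 1 + infsum ?f {k<..}" by simp
    qed
    show "(\<lambda>k. 1 + infsum ?f {k<..}) \<longlonglongrightarrow> 1"
      using tendsto_add[OF tendsto_const[of 1] 1] unfolding tail by simp
  qed
  then have "(\<lambda>k. infsum ?f (rough k) / zeta \<sigma>) \<longlonglongrightarrow> 1 / zeta \<sigma>"
    using zeta_ge_1[OF assms] by (intro tendsto_intros) auto
  then have "(\<lambda>k. \<Prod>i<Suc k. if prime i then 1 - real i powr - \<sigma> else 1) \<longlonglongrightarrow> 1 / zeta \<sigma>"
    using zeta_ge_1[OF assms] unfolding infsum_rough[OF assms] by simp
  then show ?thesis by (rule LIMSEQ_imp_Suc)
qed

lemma prime_powr_less_1:
  assumes "prime p" "\<sigma> > 0"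
  shows "real p powr - \<sigma> < 1"
  using assms prime_gt_1_nat[of p] by (intro powr_less_one) auto

lemma ln_zeta_sums:
  assumes "\<sigma> > 1"
  shows "(\<lambda>i. if prime i then - ln (1 - real i powr - \<sigma>) else 0) sums ln (zeta \<sigma>)"
proof -
  let ?g = "\<lambda>i. if prime i then 1 - real i powr - \<sigma> else 1"
  have pos: "?g i > 0" for i
    using prime_powr_less_1[of i \<sigma>] assms by auto
  have "(\<lambda>k. - ln (\<Prod>i<k. ?g i)) \<longlonglongrightarrow> - ln (1 / zeta \<sigma>)"
    using zeta_ge_1[OF assms] by (intro tendsto_intros euler_product assms) auto
  also have "(\<lambda>k. - ln (\<Prod>i<k. ?g i)) = (\<lambda>k. \<Sum>i<k. if prime i then - ln (1 - real i powr - \<sigma>) else 0)"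
    using pos by (subst ln_prod) (auto simp: sum_negf[symmetric] less_le intro!: ext sum.cong)
  also have "- ln (1 / zeta \<sigma>) = ln (zeta \<sigma>)"
    using zeta_ge_1[OF assms] by (simp add: ln_div)
  finally show ?thesis unfolding sums_def .
qed

section \<open>The pole of zeta at 1, by a telescoping comparison\<close>

lemma powr_minus_diff_bounds:
  fixes s a :: real
  assumes "s > 0" "a > 0"
  shows "s * (a + 1) powr - (1 + s) \<le> a powr - s - (a + 1) powr - s"
    and "a powr - s - (a + 1) powr - s \<le> s * a powr - (1 + s)"
proof -
  have "((\<lambda>x. x powr - s) has_real_derivative - s * x powr (- s - 1)) (at x)" if "a \<le> x" for x :: real
    using assms that by (auto intro!: derivative_eq_intros)
  with MVT2[of a "a + 1" "\<lambda>x. x powr - s" "\<lambda>x. - s * x powr (- s - 1)"]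
  have "\<exists>z>a. z < a + 1 \<and>
      (a + 1) powr - s - a powr - s = (a + 1 - a) * (- s * z powr (- s - 1))"
    by auto
  moreover have "- s - 1 = - (1 + s)" by simp
  ultimately have "\<exists>z>a. z < a + 1 \<and> a powr - s - (a + 1) powr - s = s * z powr - (1 + s)"
    by (metis (no_types, opaque_lifting) add_diff_cancel_left' minus_diff_eq mult_1 mult_minus_left)
  then obtain z where z: "a < z" "z < a + 1"
    and eq: "a powr - s - (a + 1) powr - s = s * z powr - (1 + s)"
    by blast
  have "(a + 1) powr - (1 + s) \<le> z powr - (1 + s)" "z powr - (1 + s) \<le> a powr - (1 + s)"
    using z assms by (auto intro!: powr_mono2')
  then show "s * (a + 1) powr - (1 + s) \<le> a powr - s - (a + 1) powr - s"
    "a powr - s - (a + 1) powr - s \<le> s * a powr - (1 + s)"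
    using assms unfolding eq by auto
qed

text \<open>The telescoping series of the differences of \<open>n powr - s\<close> has sum 1. By the
  mean value bounds it lies termwise between \<open>s\<close> times the zeta series without its
  first term and \<open>s\<close> times the full series.\<close>

lemma zeta_bounds:
  assumes "s > 0"
  shows "1 \<le> s * zeta (1 + s)" "s * zeta (1 + s) \<le> 1 + s"
proof -
  let ?f = "\<lambda>n. real (Suc n) powr - (1 + s)"
  let ?d = "\<lambda>n. real (Suc n) powr - s - real (Suc (Suc n)) powr - s"
  have sm: "summable (\<lambda>n. real n powr - (1 + s))" using assms by (subst summable_real_powr_iff) auto
  then have sm1: "summable ?f" by (subst summable_Suc_iff)
  then have sm2: "summable (\<lambda>n. ?f (Suc n))" by (subst summable_Suc_iff)
  have "((\<lambda>n. real n powr - (1 + s)) has_sum zeta (1 + s)) {0<..}"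
    unfolding zeta_def using assms by (intro has_sum_infsum powr_minus_summable_on) auto
  also have "{0<..} = range Suc" by (auto simp: image_iff gr0_conv_Suc)
  finally have "(?f has_sum zeta (1 + s)) UNIV"
    by (subst (asm) has_sum_reindex) (auto simp: o_def)
  then have z: "?f sums zeta (1 + s)" by (rule has_sum_imp_sums)
  then have z2: "(\<lambda>n. ?f (Suc n)) sums (zeta (1 + s) - 1)" 
    using sums_Suc_iff[of ?f "zeta (1 + s) - 1"] by simp
  have "(\<lambda>n. real (Suc n) powr - s) \<longlonglongrightarrow> 0" using assms by real_asymp
  from telescope_sums'[OF this] have d: "?d sums 1" by simp
  have 1: "?d n \<le> s * ?f n" "s * ?f (Suc n) \<le> ?d n" for n
    using powr_minus_diff_bounds[OF assms, of "real (Suc n)"] by (auto simp: add_ac)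
  show "1 \<le> s * zeta (1 + s)"
    by (rule sums_le[OF _ d sums_mult[OF z]]) (use 1 in auto)
  have "s * (zeta (1 + s) - 1) \<le> 1"
    by (rule sums_le[OF _ sums_mult[OF z2] d]) (use 1 in auto)
  then show "s * zeta (1 + s) \<le> 1 + s" by (simp add: algebra_simps)
qed

section \<open>Logarithmic Euler factors as weights on the primes\<close>

definition mertens_weight :: "nat \<Rightarrow> real" where
  "mertens_weight n = (if prime n then - ln (1 - 1 / real n) else 0)"

text \<open>The upper bound combines \<open>ln y \<le> y - 1\<close> at
  \<open>y = 1 / (1 - x)\<close> with a crude quadratic estimate. The range
  \<open>x \<le> 1 / 2\<close> covers all reciprocals of primes.\<close>

lemma ln_one_minus_bounds:
  fixes x :: real
  assumes "0 \<le> x" "x \<le> 1 / 2"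
  shows "x \<le> - ln (1 - x)" "- ln (1 - x) \<le> x + 2 * x\<^sup>2"
proof -
  show "x \<le> - ln (1 - x)" using ln_add_one_self_le_self2[of "-x"] assms by simp
  have "- ln (1 - x) = ln (1 / (1 - x))" using assms by (simp add: ln_div)
  also have "\<dots> \<le> 1 / (1 - x) - 1" using assms by (intro ln_le_minus_one) auto
  also have "\<dots> \<le> x + 2 * x\<^sup>2"
  proof -
    have "0 \<le> x\<^sup>2 * (1 - 2 * x)" using assms by simp
    then have "1 \<le> (1 + x + 2 * x\<^sup>2) * (1 - x)" by (simp add: algebra_simps power2_eq_square)
    then have "1 / (1 - x) \<le> 1 + x + 2 * x\<^sup>2" using assms by (simp add: divide_le_eq)
    then show ?thesis by simp
  qed
  finally show "- ln (1 - x) \<le> x + 2 * x\<^sup>2" .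
qed

lemma mertens_weight_nonneg: "mertens_weight n \<ge> 0"
proof (cases "prime n")
  case True
  then show ?thesis
    using ln_one_minus_bounds(1)[of "1 / real n"] prime_ge_2_nat[of n]
    by (simp add: mertens_weight_def field_simps)
qed (simp add: mertens_weight_def)

text \<open>With \<open>x = 1 / n\<close> and \<open>y\<close> equal to \<open>n\<close> to the
  power \<open>- s\<close>, both \<open>- ln (1 - x) * y\<close> and \<open>- ln (1 - x * y)\<close>
  lie between \<open>x * y\<close> and \<open>x * y + 2 * x^2\<close>. The bound is independent of
  \<open>s\<close>, so it can serve as a summable majorant as \<open>s\<close> tends to 0.\<close>

lemma mertens_weight_zeta_diff:
  assumes "s \<ge> 0"
  shows "\<bar>mertens_weight n * exp (- (s * ln (real n))) -
            (if prime n then - ln (1 - real n powr - (1 + s)) else 0)\<bar> \<le> 2 * (1 / real n)\<^sup>2"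
proof (cases "prime n")
  case True
  define x where "x = 1 / real n"
  define y where "y = exp (- (s * ln (real n)))"
  have n: "real n \<ge> 2" using prime_ge_2_nat[OF True] by simp
  have x: "0 \<le> x" "x \<le> 1 / 2" using n by (auto simp: x_def field_simps)
  have y: "0 \<le> y" "y \<le> 1" using n assms by (auto simp: y_def)
  have xy: "0 \<le> x * y" "x * y \<le> 1 / 2" using x y mult_mono[of x "1/2" y 1] by auto
  have "x = exp (- ln (real n))" using n by (simp add: x_def exp_minus inverse_eq_divide)
  then have "real n powr - (1 + s) = x * y"
    using n by (simp add: powr_def y_def algebra_simps flip: exp_add)
  then have eq: "mertens_weight n * exp (- (s * ln (real n))) -
            (if prime n then - ln (1 - real n powr - (1 + s)) else 0) =
         - ln (1 - x) * y - (- ln (1 - x * y))"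
    using True by (simp add: mertens_weight_def x_def y_def)
  have 1: "x * y \<le> - ln (1 - x) * y" "- ln (1 - x) * y \<le> (x + 2 * x\<^sup>2) * y"
    using ln_one_minus_bounds[OF x] y by (intro mult_right_mono; simp)+
  have 2: "x\<^sup>2 * y \<le> x\<^sup>2" "(x * y)\<^sup>2 \<le> x\<^sup>2"
    using x y xy by (auto intro!: mult_left_le power_mono)
  have "\<bar>- ln (1 - x) * y - (- ln (1 - x * y))\<bar> \<le> 2 * x\<^sup>2"
    using 1 2 ln_one_minus_bounds[OF xy] by (auto simp: algebra_simps)
  then show ?thesis unfolding eq x_def by simp
qed (simp add: mertens_weight_def)

lemma summable_mertens_weight:
  assumes "s > 0"
  shows "summable (\<lambda>n. mertens_weight n * exp (- (s * ln (real n))))"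
    and "(\<Sum>n. mertens_weight n * exp (- (s * ln (real n))) -
           (if prime n then - ln (1 - real n powr - (1 + s)) else 0)) =
         (\<Sum>n. mertens_weight n * exp (- (s * ln (real n)))) - ln (zeta (1 + s))"
proof -
  let ?f = "\<lambda>n. mertens_weight n * exp (- (s * ln (real n)))"
  let ?g = "\<lambda>n. if prime n then - ln (1 - real n powr - (1 + s)) else 0"
  have g: "?g sums ln (zeta (1 + s))" using ln_zeta_sums[of "1 + s"] assms by simp
  have sq: "summable (\<lambda>n. 2 * (1 / real n)\<^sup>2)"
    using inverse_power_summable[of 2, where 'a=real] by (intro summable_mult) (simp add: divide_inverse power_inverse)
  have "summable (\<lambda>n. ?f n - ?g n)"
    using mertens_weight_zeta_diff[of s] assms
    by (intro summable_comparison_test[OF _ sq]) auto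
  then have "summable (\<lambda>n. ?f n - ?g n + ?g n)" using g by (intro summable_add) (auto simp: sums_iff)
  then show f: "summable ?f" by simp
  show "(\<Sum>n. ?f n - ?g n) = (\<Sum>n. ?f n) - ln (zeta (1 + s))"
    using suminf_diff[OF f sums_summable[OF g]] sums_unique[OF g] by simp
qed

text \<open>Each term of the difference from the series for \<open>ln (zeta (1 + s))\<close> tends
  to 0, and the uniform majorant allows the limit to be taken termwise. What is left is
  \<open>ln (zeta (1 + s)) = - ln s + o(1)\<close>. Writing \<open>ln (1 - exp (- s))\<close> in
  place of \<open>ln s\<close> changes this by \<open>o(1)\<close> and matches the harmonic series
  exactly.\<close>

lemma mertens_weight_abel_limit:
  "((\<lambda>s. (\<Sum>n. mertens_weight n * exp (- (s * ln (real n)))) + ln (1 - exp (- s))) \<longlongrightarrow> 0) (at_right 0)"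
proof -
  let ?F = "\<lambda>s. \<Sum>n. mertens_weight n * exp (- (s * ln (real n)))"
  let ?d = "\<lambda>n s. mertens_weight n * exp (- (s * ln (real n))) -
           (if prime n then - ln (1 - real n powr - (1 + s)) else 0)"
  have "((\<lambda>s. \<Sum>n. ?d n s) \<longlongrightarrow> (\<Sum>n::nat. 0)) (at_right 0)"
  proof (rule conjunct2[OF conjunct2[OF tannerys_theorem]])
    fix n
    show "(?d n \<longlongrightarrow> 0) (at_right 0)"
    proof (cases "prime n")
      case True
      then have n: "real n > 1" using prime_gt_1_nat by simp
      have "((\<lambda>s. mertens_weight n * exp (- (s * ln (real n))) - (- ln (1 - real n powr - (1 + s))))
          \<longlongrightarrow> mertens_weight n * exp (- (0 * ln (real n))) - (- ln (1 - real n powr - (1 + 0))))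
          (at_right 0)"
        by (intro tendsto_intros) (use n in \<open>auto simp: powr_minus\<close>)
      then show ?thesis using n True by (simp add: mertens_weight_def powr_minus field_simps)
    qed (simp add: mertens_weight_def)
    show "summable (\<lambda>n. 2 * (1 / real n)\<^sup>2)"
      using inverse_power_summable[of 2, where 'a=real] by (intro summable_mult) (simp add: divide_inverse power_inverse)
    show "\<forall>\<^sub>F (n, s) in at_top \<times>\<^sub>F at_right 0. norm (?d n s) \<le> 2 * (1 / real n)\<^sup>2"
      unfolding case_prod_beta real_norm_def
      by (rule eventually_mono[OF eventually_prodI[OF eventually_True eventually_at_right_less]])
         (use mertens_weight_zeta_diff less_imp_le in blast)
  qed simp
  then have "((\<lambda>s. ?F s - ln (zeta (1 + s))) \<longlongrightarrow> 0) (at_right 0)"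
    unfolding suminf_zero
    by (rule Lim_transform_eventually) (use summable_mertens_weight(2) in \<open>auto simp: eventually_at_filter\<close>)
  moreover have "((\<lambda>s. s * zeta (1 + s)) \<longlongrightarrow> 1) (at_right 0)"
  proof (rule tendsto_sandwich[OF _ _ tendsto_const])
    show "\<forall>\<^sub>F s in at_right 0. 1 \<le> s * zeta (1 + s)" "\<forall>\<^sub>F s in at_right 0. s * zeta (1 + s) \<le> 1 + s"
      using zeta_bounds by (auto simp: eventually_at_filter)
    show "((\<lambda>s. 1 + s) \<longlongrightarrow> 1) (at_right (0::real))" by real_asymp
  qed
  then have "((\<lambda>s. ln (s * zeta (1 + s))) \<longlongrightarrow> ln 1) (at_right 0)"
    by (intro tendsto_ln) auto
  moreover have "((\<lambda>s. ln ((1 - exp (- s)) / s)) \<longlongrightarrow> 0) (at_right (0::real))" by real_asymp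
  ultimately have lim: "((\<lambda>s. ?F s - ln (zeta (1 + s)) + ln (s * zeta (1 + s)) + ln ((1 - exp (- s)) / s))
      \<longlongrightarrow> 0 + ln 1 + 0) (at_right 0)"
    by (intro tendsto_add)
  have "\<forall>\<^sub>F s in at_right 0. ?F s - ln (zeta (1 + s)) + ln (s * zeta (1 + s)) + ln ((1 - exp (- s)) / s) =
      ?F s + ln (1 - exp (- s))"
    using eventually_at_right_less
  proof eventually_elim
    case (elim s)
    then show ?case using zeta_ge_1[of "1 + s"] by (simp add: ln_mult_pos ln_div)
  qed
  from Lim_transform_eventually[OF lim this] show ?thesis by simp
qed

section \<open>A Tauberian theorem\<close>

text \<open>\<open>karamata_fn t\<close> is \<open>(g t - t) / (t (1 - t))\<close> for the indicator function \<open>g\<close> of \<open>t \<ge> 1/e\<close>.\<close>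
definition karamata_fn :: "real \<Rightarrow> real" where
  "karamata_fn t = (if t < exp (- 1) then - 1 / (1 - t) else 1 / t)"

section \<open>Polynomials enclosing a function with a jump\<close>

lemma real_polynomial_approx_from_above:
  fixes h :: "real \<Rightarrow> real"
  assumes "continuous_on {0..1} h" "e > 0"
  obtains q where "real_polynomial_function q" "\<And>t. t \<in> {0..1} \<Longrightarrow> h t \<le> q t"
    "\<And>t. t \<in> {0..1} \<Longrightarrow> q t \<le> h t + e"
proof -
  \<comment> \<open>Aiming at \<open>h + e / 2\<close> with tolerance \<open>e / 2\<close> turns
    uniform approximation into approximation from above.\<close>
  have "continuous_on {0..1} (\<lambda>t. h t + e / 2)" by (intro continuous_intros assms)
  then obtain q where q: "real_polynomial_function q"
      "\<And>t. t \<in> {0..1} \<Longrightarrow> \<bar>h t + e / 2 - q t\<bar> < e / 2"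
    using Stone_Weierstrass_real_polynomial_function[of "{0..1}" "\<lambda>t. h t + e / 2" "e / 2"] assms
    by auto
  show ?thesis
  proof (rule that[OF q(1)])
    fix t :: real assume "t \<in> {0..1}"
    from q(2)[OF this] show "h t \<le> q t" "q t \<le> h t + e" by (auto simp: abs_if split: if_splits)
  qed
qed

text \<open>The jump at \<open>exp (- 1)\<close> is replaced by a linear ramp placed just after it
  for the lower function and just before it for the upper one. The two differ only within distance
  \<open>d\<close> of the jump, and by no more than its height.\<close>

lemma karamata_sandwich_continuous:
  fixes d :: real
  assumes d: "d > 0"
  obtains h1 h2 where "continuous_on {0..1} h1" "continuous_on {0..1} h2"
    "\<And>t. t \<in> {0..1} \<Longrightarrow> h1 t \<le> karamata_fn t" "\<And>t. t \<in> {0..1} \<Longrightarrow> karamata_fn t \<le> h2 t"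
    "\<And>t. t \<in> {0..1} \<Longrightarrow> h2 t - h1 t \<le>
       (if t \<in> {exp (- 1) - d..exp (- 1) + d} then exp 1 + 1 / (1 - exp (- 1)) else 0)"
proof -
  define a :: real where "a = exp (- 1)"
  have a: "0 < a" "a < 1" by (auto simp: a_def)
  \<comment> \<open>\<open>b\<close> continues the left branch by a constant beyond
    \<open>a\<close>, and \<open>j\<close> is chosen so that \<open>b + j\<close> is the right
    branch from \<open>a\<close> on.\<close>
  define b where "b = (\<lambda>t. - 1 / (1 - min t a))"
  define j where "j = (\<lambda>t. 1 / max t a + 1 / (1 - min t a))"
  define r1 where "r1 = (\<lambda>t. max 0 (min 1 ((t - a) / d)))"
  define r2 where "r2 = (\<lambda>t. max 0 (min 1 ((t - a + d) / d)))"
  have j: "0 \<le> j t" "j t \<le> 1 / a + 1 / (1 - a)" for t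
  proof -
    have "0 \<le> 1 / max t a" "1 / max t a \<le> 1 / a" "0 \<le> 1 / (1 - min t a)"
         "1 / (1 - min t a) \<le> 1 / (1 - a)"
      using a by (auto intro!: divide_left_mono simp: max_def min_def)
    then show "0 \<le> j t" "j t \<le> 1 / a + 1 / (1 - a)" unfolding j_def by linarith+
  qed
  have r: "0 \<le> r1 t" "r1 t \<le> 1" "0 \<le> r2 t" "r2 t \<le> 1" for t by (auto simp: r1_def r2_def)
  have r1_0: "r1 t = 0" if "t \<le> a" for t using that d by (auto simp: r1_def field_simps max_def min_def)
  have r2_1: "r2 t = 1" if "t \<ge> a" for t using that d by (auto simp: r2_def field_simps max_def min_def)
  have r1_1: "r1 t = 1" if "t \<ge> a + d" for t using that d by (auto simp: r1_def field_simps max_def min_def)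
  have r2_0: "r2 t = 0" if "t \<le> a - d" for t using that d by (auto simp: r2_def field_simps max_def min_def)
  have G: "karamata_fn t = (if t < a then b t else b t + j t)" for t
    by (auto simp: karamata_fn_def a_def[symmetric] b_def j_def)
  show ?thesis
  proof (rule that[of "\<lambda>t. b t + j t * r1 t" "\<lambda>t. b t + j t * r2 t"])
    show "continuous_on {0..1} (\<lambda>t. b t + j t * r1 t)"
      unfolding b_def j_def r1_def using a d
      by (intro continuous_intros) (auto simp: max_def min_def)
    show "continuous_on {0..1} (\<lambda>t. b t + j t * r2 t)"
      unfolding b_def j_def r2_def using a d
      by (intro continuous_intros) (auto simp: max_def min_def)
  next
    fix t :: real assume "t \<in> {0..1}"
    show "b t + j t * r1 t \<le> karamata_fn t"
      using r1_0[of t] j[of t] r[of t] mult_left_le[of "r1 t" "j t"] by (auto simp: G)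
    show "karamata_fn t \<le> b t + j t * r2 t"
      using r2_1[of t] j[of t] r[of t] by (auto simp: G)
    have "j t * (r2 t - r1 t) \<le> (if t \<in> {a - d..a + d} then 1 / a + 1 / (1 - a) else 0)"
    proof (cases "t \<in> {a - d..a + d}")
      case True
      have "j t * (r2 t - r1 t) \<le> j t * 1" using r[of t] j[of t] by (intro mult_left_mono) auto
      with True j[of t] show ?thesis by simp
    next
      case False
      then have "r2 t = r1 t" using r1_0[of t] r1_1[of t] r2_0[of t] r2_1[of t] d by force
      with False show ?thesis by (simp only: if_False diff_self mult_zero_right order_refl)
    qed
    moreover have "1 / a = exp 1" by (simp add: a_def exp_minus divide_inverse)
    ultimately show "b t + j t * r2 t - (b t + j t * r1 t) \<le>
       (if t \<in> {exp (- 1) - d..exp (- 1) + d} then exp 1 + 1 / (1 - exp (- 1)) else 0)"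
      unfolding a_def by (auto simp: algebra_simps split: if_splits)
  qed
qed

text \<open>The continuous bounds are approximated by polynomials from outside, the lower one by
  approximating \<open>- h1\<close> from above. The error budget is \<open>e / 4\<close> for each
  polynomial and \<open>e / 2\<close> for the ramps.\<close>

lemma karamata_sandwich:
  fixes e :: real
  assumes "e > 0"
  obtains q1 q2 where "real_polynomial_function q1" "real_polynomial_function q2"
    "\<And>t. t \<in> {0..1} \<Longrightarrow> q1 t \<le> karamata_fn t" "\<And>t. t \<in> {0..1} \<Longrightarrow> karamata_fn t \<le> q2 t"
    "integral {0..1} (\<lambda>t. q2 t - q1 t) \<le> e"
proof -
  define C :: real where "C = exp 1 + 1 / (1 - exp (- 1))"
  have C: "C > 0" by (auto simp: C_def intro!: add_pos_pos)
  \<comment> \<open>A window of length at most \<open>2 * d\<close> and height \<open>C\<close> then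
    has area at most \<open>e / 2\<close>.\<close>
  define d where "d = e / (4 * C)"
  have d: "d > 0" using assms C by (simp add: d_def)
  define a :: real where "a = exp (- 1)"
  obtain h1 h2 where h: "continuous_on {0..1} h1" "continuous_on {0..1} h2"
    "\<And>t. t \<in> {0..1} \<Longrightarrow> h1 t \<le> karamata_fn t" "\<And>t. t \<in> {0..1} \<Longrightarrow> karamata_fn t \<le> h2 t"
    "\<And>t. t \<in> {0..1} \<Longrightarrow> h2 t - h1 t \<le> (if t \<in> {a - d..a + d} then C else 0)"
    using karamata_sandwich_continuous[OF d] unfolding C_def a_def by metis
  obtain q2 where q2: "real_polynomial_function q2" "\<And>t. t \<in> {0..1} \<Longrightarrow> h2 t \<le> q2 t"
    "\<And>t. t \<in> {0..1} \<Longrightarrow> q2 t \<le> h2 t + e / 4"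
    using real_polynomial_approx_from_above[OF h(2), of "e / 4"] assms by auto
  have "continuous_on {0..1} (\<lambda>t. - h1 t)" by (intro continuous_intros h)
  then obtain p where p: "real_polynomial_function p" "\<And>t. t \<in> {0..1} \<Longrightarrow> - h1 t \<le> p t"
    "\<And>t. t \<in> {0..1} \<Longrightarrow> p t \<le> - h1 t + e / 4"
    using real_polynomial_approx_from_above[of "\<lambda>t. - h1 t" "e / 4"] assms by auto
  define q1 where "q1 = (\<lambda>t. - p t)"
  have q1: "real_polynomial_function q1" unfolding q1_def by (rule real_polynomial_function_minus[OF p(1)])
  have int: "(\<lambda>t. if t \<in> {a - d..a + d} then C else 0) integrable_on {0..1}"
    by (subst integrable_restrict_Int) (simp add: Int_atLeastAtMost integrable_continuous_interval)
  have "integral {0..1} (\<lambda>t. q2 t - q1 t) \<le>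
          integral {0..1} (\<lambda>t. e / 2 + (if t \<in> {a - d..a + d} then C else 0))"
  proof (rule integral_le)
    have "continuous_on {0..1} (\<lambda>t. q2 t - q1 t)"
      using q1 q2(1)
      by (intro continuous_intros continuous_on_polymonial_function)
         (auto simp: real_polynomial_function_eq)
    then show "(\<lambda>t. q2 t - q1 t) integrable_on {0..1}" by (rule integrable_continuous_interval)
    show "(\<lambda>t. e / 2 + (if t \<in> {a - d..a + d} then C else 0)) integrable_on {0..1}"
      by (intro integrable_add int) auto
  next
    fix t :: real assume t: "t \<in> {0..1}"
    show "q2 t - q1 t \<le> e / 2 + (if t \<in> {a - d..a + d} then C else 0)"
      using q2(3)[OF t] p(3)[OF t] h(5)[OF t] by (simp add: q1_def)
  qed
  also have "\<dots> = e / 2 + integral {0..1} (\<lambda>t. if t \<in> {a - d..a + d} then C else 0)"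
    by (subst integral_add) (use int in auto)
  also have "integral {0..1} (\<lambda>t. if t \<in> {a - d..a + d} then C else 0) =
      integral {max (a - d) 0..min (a + d) 1} (\<lambda>t. C)"
    by (simp only: integral_restrict_Int Int_atLeastAtMost)
  also have "\<dots> \<le> 2 * d * C"
    using C d by (auto intro!: mult_right_mono simp: content_real_if)
  also have "e / 2 + 2 * d * C = e" using C by (simp add: d_def)
  finally have "integral {0..1} (\<lambda>t. q2 t - q1 t) \<le> e" by simp
  moreover have "q1 t \<le> karamata_fn t" if "t \<in> {0..1}" for t using p(2)[OF that] h(3)[OF that] by (simp add: q1_def)
  moreover have "karamata_fn t \<le> q2 t" if "t \<in> {0..1}" for t using q2(2)[OF that] h(4)[OF that] by simp
  ultimately show ?thesis using that q1 q2(1) by blast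
qed

section \<open>Exponential sums with nonnegative weights\<close>

definition exp_sum :: "(nat \<Rightarrow> real) \<Rightarrow> (nat \<Rightarrow> real) \<Rightarrow> (real \<Rightarrow> real) \<Rightarrow> real \<Rightarrow> real" where
  "exp_sum w u h s = (\<Sum>n. w n * h (exp (- (s * u n))))"

text \<open>Vanishing at least linearly at 0 makes \<open>exp_sum\<close> converge by comparison
  with the case where \<open>h\<close> is the identity.\<close>

definition lin_bounded :: "(real \<Rightarrow> real) \<Rightarrow> bool" where
  "lin_bounded h \<longleftrightarrow> (\<exists>C. \<forall>t\<in>{0..1}. \<bar>h t\<bar> \<le> C * t)"

lemma lin_boundedI: "(\<And>t. 0 \<le> t \<Longrightarrow> t \<le> 1 \<Longrightarrow> \<bar>h t\<bar> \<le> C * t) \<Longrightarrow> lin_bounded h"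
  unfolding lin_bounded_def by (intro exI[of _ C]) auto

lemma lin_bounded_add:
  assumes "lin_bounded f" "lin_bounded g"
  shows "lin_bounded (\<lambda>t. f t + g t)"
proof -
  from assms obtain C D where "\<forall>t\<in>{0..1}. \<bar>f t\<bar> \<le> C * t" "\<forall>t\<in>{0..1}. \<bar>g t\<bar> \<le> D * t"
    by (auto simp: lin_bounded_def)
  then show ?thesis
    by (intro lin_boundedI[of _ "C + D"]) (fastforce simp: algebra_simps intro: order_trans[OF abs_triangle_ineq] add_mono)
qed

lemma lin_bounded_cmult:
  assumes "lin_bounded f"
  shows "lin_bounded (\<lambda>t. c * f t)"
proof -
  from assms obtain C where "\<forall>t\<in>{0..1}. \<bar>f t\<bar> \<le> C * t" by (auto simp: lin_bounded_def)
  then show ?thesis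
    by (intro lin_boundedI[of _ "\<bar>c\<bar> * C"]) (auto simp: abs_mult mult.assoc intro!: mult_left_mono)
qed

lemma lin_bounded_power: "lin_bounded (\<lambda>t. t ^ Suc j)"
  by (rule lin_boundedI[of _ 1]) (auto intro!: mult_left_le power_le_one)

text \<open>The weight \<open>w n\<close> sits at the point \<open>u n\<close>. Taking
  \<open>h\<close> as the identity in \<open>exp_sum\<close> gives the Abel-type sum at
  \<open>s\<close>, and taking it as an indicator function gives a partial sum.\<close>

locale exp_weights =
  fixes w u :: "nat \<Rightarrow> real"
  assumes w_nonneg: "0 \<le> w n" and u_nonneg: "0 \<le> u n"
    and summable_exp: "s > 0 \<Longrightarrow> summable (\<lambda>n. w n * exp (- (s * u n)))"
begin

lemma exp_sum_summable:
  assumes "lin_bounded h" "s > 0"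
  shows "summable (\<lambda>n. w n * h (exp (- (s * u n))))"
proof -
  obtain C where C: "\<forall>t\<in>{0..1}. \<bar>h t\<bar> \<le> C * t"
    using assms(1) unfolding lin_bounded_def by blast
  have "summable (\<lambda>n. C * (w n * exp (- (s * u n))))"
    by (intro summable_mult summable_exp assms)
  then show ?thesis
  proof (rule summable_comparison_test')
    fix n
    have "\<bar>h (exp (- (s * u n)))\<bar> \<le> C * exp (- (s * u n))"
      using u_nonneg[of n] assms(2) by (intro C[rule_format]) auto
    then have "w n * \<bar>h (exp (- (s * u n)))\<bar> \<le> w n * (C * exp (- (s * u n)))"
      using w_nonneg by (rule mult_left_mono)
    then show "norm (w n * h (exp (- (s * u n)))) \<le> C * (w n * exp (- (s * u n)))"
      using w_nonneg[of n] by (simp add: abs_mult mult_ac)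
  qed
qed

lemma exp_sum_add:
  assumes "lin_bounded f" "lin_bounded g" "s > 0"
  shows "exp_sum w u (\<lambda>t. f t + g t) s = exp_sum w u f s + exp_sum w u g s"
  unfolding exp_sum_def using assms
  by (subst suminf_add) (auto intro!: exp_sum_summable simp: algebra_simps)

lemma exp_sum_cmult:
  assumes "lin_bounded f" "s > 0"
  shows "exp_sum w u (\<lambda>t. c * f t) s = c * exp_sum w u f s"
  unfolding exp_sum_def using assms
  by (subst suminf_mult[symmetric]) (auto intro!: exp_sum_summable simp: algebra_simps)

lemma exp_sum_mono:
  assumes "lin_bounded f" "lin_bounded g" "s > 0" "\<And>t. t \<in> {0..1} \<Longrightarrow> f t \<le> g t"
  shows "exp_sum w u f s \<le> exp_sum w u g s"
  unfolding exp_sum_def using assms u_nonneg w_nonneg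
  by (intro suminf_le exp_sum_summable mult_left_mono) auto

end

lemma exp_minus_of_nat_mult: "exp (- (real n * x)) = exp (- x) ^ n"
  by (metis exp_of_nat_mult mult_minus_right)

text \<open>Raising \<open>t\<close> to a power only rescales \<open>s\<close>; hence a limit known
  for the identity carries over to all positive powers.\<close>

lemma exp_sum_power: "exp_sum w u (\<lambda>t. t ^ Suc j) s = exp_sum w u (\<lambda>t. t) (real (Suc j) * s)"
  unfolding exp_sum_def by (simp only: mult.assoc exp_minus_of_nat_mult)

section \<open>Harmonic weights and their Riemann sums\<close>

lemma harmonic_sums:
  fixes s :: real
  assumes "s > 0"
  shows "(\<lambda>n. 1 / real n * exp (- (s * real n))) sums - ln (1 - exp (- s))"
proof -
  \<comment> \<open>The term at \<open>n = 0\<close> is 0 because division by zero yields 0, so the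
    logarithmic series may start there.\<close>
  have "(\<lambda>n. - ((- (- exp (- s))) ^ n) / of_nat n) sums ln (1 + (- exp (- s)))"
    by (rule Complex_Transcendental.ln_series') (use assms in auto)
  from sums_minus[OF this] show ?thesis
    by (simp add: mult.commute[of s] exp_minus_of_nat_mult)
qed

interpretation harmonic: exp_weights "\<lambda>n. 1 / real n" real
  by unfold_locales (use sums_summable[OF harmonic_sums] in auto)

abbreviation harmonic_sum :: "(real \<Rightarrow> real) \<Rightarrow> real \<Rightarrow> real" where
  "harmonic_sum \<equiv> exp_sum (\<lambda>n. 1 / real n) real"

lemma lin_bounded_poly:
  fixes b :: "nat \<Rightarrow> real"
  shows "lin_bounded (\<lambda>t. t * (1 - t) * (\<Sum>i\<le>m. b i * t ^ i))"
proof (rule lin_boundedI)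
  fix t :: real assume t: "0 \<le> t" "t \<le> 1"
  have "\<bar>\<Sum>i\<le>m. b i * t ^ i\<bar> \<le> (\<Sum>i\<le>m. \<bar>b i\<bar>)"
    by (rule order_trans[OF sum_abs]) (use t in \<open>auto simp: abs_mult intro!: sum_mono mult_left_le power_le_one\<close>)
  moreover have "\<bar>t * (1 - t)\<bar> \<le> t" using t by (auto simp: abs_mult intro!: mult_left_le)
  ultimately have "\<bar>t * (1 - t)\<bar> * \<bar>\<Sum>i\<le>m. b i * t ^ i\<bar> \<le> t * (\<Sum>i\<le>m. \<bar>b i\<bar>)"
    using t by (intro mult_mono) auto
  then show "\<bar>t * (1 - t) * (\<Sum>i\<le>m. b i * t ^ i)\<bar> \<le> (\<Sum>i\<le>m. \<bar>b i\<bar>) * t"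
    by (simp add: abs_mult mult_ac)
qed

lemma integral_polynomial_unit:
  fixes b :: "nat \<Rightarrow> real"
  shows "integral {0..1} (\<lambda>t. \<Sum>i\<le>m. b i * t ^ i) = (\<Sum>i\<le>m. b i * (1 / real (Suc i)))"
proof -
  have "((\<lambda>t::real. t ^ i) has_integral (1 / real (Suc i))) {0..1}" for i
  proof -
    have "((\<lambda>t::real. t ^ i) has_integral (1 ^ Suc i / real (Suc i) - 0 ^ Suc i / real (Suc i))) {0..1}"
      by (rule fundamental_theorem_of_calculus)
         (auto intro!: derivative_eq_intros simp flip: has_real_derivative_iff_has_vector_derivative simp del: power_Suc)
    then show ?thesis by simp
  qed
  then show ?thesis
    by (intro integral_unique has_integral_sum has_integral_mult_right) auto
qed

text \<open>Since \<open>(1 - x\<^sup>n) / n \<le> 1 - x\<close>, the harmonic sum is dominated by a Riemann sum for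
  \<open>\<integral> q\<close> along a geometric partition.\<close>
lemma harmonic_sum_eventually_le:
  assumes q: "real_polynomial_function q" "\<And>t. t \<in> {0..1} \<Longrightarrow> 0 \<le> q t"
    and B: "integral {0..1} q < B"
  shows "\<forall>\<^sub>F s in at_right 0. harmonic_sum (\<lambda>t. t * (1 - t) * q t) s < B"
proof -
  obtain b m where qb: "q = (\<lambda>t. \<Sum>i\<le>m. b i * t ^ i)"
    using q(1) unfolding real_polynomial_function_iff_sum by blast
  \<comment> \<open>With \<open>x = exp (- s)\<close> this is the Riemann sum over \<open>k\<close>
    of \<open>(1 - x) * x^(k+1) * q (x^(k+1))\<close>, evaluated monomial by monomial as geometric
    series.\<close>
  define R where "R = (\<lambda>s::real. \<Sum>i\<le>m. b i * ((1 - exp (- s)) * exp (- (real (Suc i) * s)) / (1 - exp (- (real (Suc i) * s)))))"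
  have "((\<lambda>s::real. (1 - exp (- s)) * exp (- (c * s)) / (1 - exp (- (c * s)))) \<longlongrightarrow> inverse c) (at_right 0)"
    if "c > 0" for c using that by real_asymp
  then have "(R \<longlongrightarrow> (\<Sum>i\<le>m. b i * (1 / real (Suc i)))) (at_right 0)"
    unfolding R_def inverse_eq_divide[symmetric] by (intro tendsto_sum tendsto_mult tendsto_const) auto
  then have "\<forall>\<^sub>F s in at_right 0. R s < B"
    using B by (intro order_tendstoD) (auto simp: qb integral_polynomial_unit)
  with eventually_at_right_less show ?thesis
  proof eventually_elim
    case (elim s)
    define x where "x = exp (- s)"
    have x: "0 < x" "x < 1" using elim by (auto simp: x_def)
    have xn: "exp (- (s * real n)) = x ^ n" for n
      by (simp only: x_def mult.commute[of s] exp_minus_of_nat_mult)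
    have Rx: "R s = (\<Sum>i\<le>m. b i * ((1 - x) * (x ^ Suc i / (1 - x ^ Suc i))))"
      unfolding R_def x_def by (simp only: exp_minus_of_nat_mult times_divide_eq_right)
    have geom: "(\<lambda>k. y ^ Suc k) sums (y / (1 - y))" if "0 < y" "y < 1" for y :: real
      using sums_mult[OF geometric_sums[of y], of y] that by simp
    have "(\<lambda>k. b i * ((1 - x) * (x ^ Suc i) ^ Suc k)) sums
        (b i * ((1 - x) * (x ^ Suc i / (1 - x ^ Suc i))))" for i
      by (rule sums_mult, rule sums_mult, rule geom) (use x in \<open>auto intro: power_Suc_less_one simp del: power_Suc\<close>)
    then have "(\<lambda>k. \<Sum>i\<le>m. b i * ((1 - x) * (x ^ Suc i) ^ Suc k)) sums R s"
      unfolding Rx by (rule sums_sum)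
    also have "(\<lambda>k. \<Sum>i\<le>m. b i * ((1 - x) * (x ^ Suc i) ^ Suc k)) = (\<lambda>k. (1 - x) * x ^ Suc k * q (x ^ Suc k))"
    proof
      fix k
      have "(x ^ Suc i) ^ Suc k = x ^ Suc k * (x ^ Suc k) ^ i" for i
        by (simp only: power_mult [symmetric] power_add [symmetric]) (simp add: algebra_simps)
      then show "(\<Sum>i\<le>m. b i * ((1 - x) * (x ^ Suc i) ^ Suc k)) = (1 - x) * x ^ Suc k * q (x ^ Suc k)"
        unfolding qb sum_distrib_left by (intro sum.cong refl) (simp only: mult_ac)
    qed
    finally have R: "(\<lambda>k. (1 - x) * x ^ Suc k * q (x ^ Suc k)) sums R s" .
    let ?f = "\<lambda>n. 1 / real n * (x ^ n * (1 - x ^ n) * q (x ^ n))"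
    have "summable ?f"
      using harmonic.exp_sum_summable[of "\<lambda>t. t * (1 - t) * q t" s] lin_bounded_poly elim
      unfolding xn qb by auto
    then have "?f sums harmonic_sum (\<lambda>t. t * (1 - t) * q t) s"
      unfolding exp_sum_def xn by (rule summable_sums)
    then have H: "(\<lambda>n. ?f (Suc n)) sums harmonic_sum (\<lambda>t. t * (1 - t) * q t) s"
      using sums_Suc_iff[of ?f] by simp
    have "?f (Suc n) \<le> (1 - x) * x ^ Suc n * q (x ^ Suc n)" for n
    proof -
      have "1 + real (Suc n) * (x - 1) \<le> (1 + (x - 1)) ^ Suc n"
        by (rule Bernoulli_inequality) (use x in auto)
      then have "1 / real (Suc n) * (1 - x ^ Suc n) \<le> 1 - x"
        by (simp add: field_simps)
      moreover have "0 \<le> x ^ Suc n * q (x ^ Suc n)"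
        using x by (intro mult_nonneg_nonneg q(2)) (auto intro!: power_le_one simp del: power_Suc)
      ultimately have "1 / real (Suc n) * (1 - x ^ Suc n) * (x ^ Suc n * q (x ^ Suc n))
          \<le> (1 - x) * (x ^ Suc n * q (x ^ Suc n))"
        by (rule mult_right_mono)
      then show ?thesis by (simp only: mult_ac)
    qed
    then have "harmonic_sum (\<lambda>t. t * (1 - t) * q t) s \<le> R s"
      by (intro sums_le[OF _ H R])
    with elim show ?case by simp
  qed
qed

section \<open>From Abel sums to sharp cutoffs\<close>

lemma filterlim_cmult_at_right_0:
  fixes c :: real
  assumes "c > 0"
  shows "filterlim (\<lambda>s. c * s) (at_right 0) (at_right 0)"
  using assms by real_asymp

text \<open>The value 1 at the jump itself makes a point with \<open>u n = x\<close> count in the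
  partial sum up to \<open>x\<close>.\<close>

definition cutoff :: "real \<Rightarrow> real" where
  "cutoff t = (if t < exp (- 1) then 0 else 1)"

text \<open>The summand \<open>t\<close> is handled by the Abel limit. The factor
  \<open>t * (1 - t)\<close> in the remainder damps both ends of the unit interval, which keeps its
  harmonic sum bounded by an integral.\<close>

lemma cutoff_eq: "cutoff t = t + t * (1 - t) * karamata_fn t"
proof (cases "t < exp (- 1)")
  case True
  moreover have "exp (- 1 :: real) < 1" by simp
  ultimately have "1 - t \<noteq> 0" by linarith
  then have "t * (1 - t) * (- 1 / (1 - t)) = - t" by simp
  with True show ?thesis by (simp add: cutoff_def karamata_fn_def)
next
  case False
  then have "t \<noteq> 0" using exp_gt_zero[of "- 1 :: real"] by auto
  then have "t * (1 - t) * (1 / t) = 1 - t" by simp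
  with False show ?thesis by (simp add: cutoff_def karamata_fn_def)
qed

lemma lin_bounded_cutoff: "lin_bounded cutoff"
proof (rule lin_boundedI)
  fix t :: real assume t: "0 \<le> t"
  have "1 \<le> exp 1 * t" if "exp (- 1) \<le> t"
    using mult_left_mono[OF that, of "exp 1"] by (simp flip: exp_add)
  then show "\<bar>cutoff t\<bar> \<le> exp 1 * t" using t by (auto simp: cutoff_def)
qed

text \<open>Since \<open>- ln (1 - exp (- s))\<close> is the harmonic sum of the identity, the
  assumption says that the weights imitate the harmonic ones up to \<open>o(1)\<close>, so additive
  constants are retained.\<close>

locale tauberian = exp_weights +
  assumes abel_limit:
    "((\<lambda>s. (\<Sum>n. w n * exp (- (s * u n))) + ln (1 - exp (- s))) \<longlongrightarrow> 0) (at_right 0)"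
begin

definition gap_null :: "(real \<Rightarrow> real) \<Rightarrow> bool" where
  "gap_null h \<longleftrightarrow> lin_bounded h \<and> ((\<lambda>s. exp_sum w u h s - harmonic_sum h s) \<longlongrightarrow> 0) (at_right 0)"

text \<open>The linearity rules for \<open>exp_sum\<close> hold for \<open>s > 0\<close> only, which
  suffices for a right-hand limit at 0.\<close>

lemma gap_null_cong_lim:
  assumes "((\<lambda>s. F s) \<longlongrightarrow> 0) (at_right 0)"
    and "\<And>s. s > 0 \<Longrightarrow> F s = exp_sum w u h s - harmonic_sum h s"
  shows "((\<lambda>s. exp_sum w u h s - harmonic_sum h s) \<longlongrightarrow> 0) (at_right 0)"
  by (rule Lim_transform_eventually[OF assms(1)]) (use assms(2) in \<open>auto simp: eventually_at_filter\<close>)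

lemma gap_null_add:
  assumes "gap_null f" "gap_null g"
  shows "gap_null (\<lambda>t. f t + g t)"
proof -
  have "((\<lambda>s. (exp_sum w u f s - harmonic_sum f s) + (exp_sum w u g s - harmonic_sum g s)) \<longlongrightarrow> 0)
      (at_right 0)"
    using assms unfolding gap_null_def by (intro tendsto_add_zero) auto
  then show ?thesis
    using assms unfolding gap_null_def
    by (auto intro!: lin_bounded_add elim!: gap_null_cong_lim simp: exp_sum_add harmonic.exp_sum_add)
qed

lemma gap_null_cmult:
  assumes "gap_null f"
  shows "gap_null (\<lambda>t. c * f t)"
proof -
  have "((\<lambda>s. c * (exp_sum w u f s - harmonic_sum f s)) \<longlongrightarrow> 0) (at_right 0)"
    using assms unfolding gap_null_def by (intro tendsto_mult_right_zero) auto
  then show ?thesis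
    using assms unfolding gap_null_def
    by (auto intro!: lin_bounded_cmult elim!: gap_null_cong_lim
        simp: exp_sum_cmult harmonic.exp_sum_cmult right_diff_distrib)
qed

lemma gap_null_power: "gap_null (\<lambda>t. t ^ Suc j)"
proof -
  have "((\<lambda>s. exp_sum w u (\<lambda>t. t) s - harmonic_sum (\<lambda>t. t) s) \<longlongrightarrow> 0) (at_right 0)"
    by (rule gap_null_cong_lim[OF abel_limit])
       (use harmonic_sums in \<open>auto simp: exp_sum_def sums_iff\<close>)
  from filterlim_compose[OF this filterlim_cmult_at_right_0[OF of_nat_0_less_iff[THEN iffD2, OF zero_less_Suc[of j]]]]
  show ?thesis unfolding gap_null_def exp_sum_power by (intro conjI lin_bounded_power)
qed

lemma gap_null_sum:
  "finite A \<Longrightarrow> (\<And>i. i \<in> A \<Longrightarrow> gap_null (f i)) \<Longrightarrow> gap_null (\<lambda>t. \<Sum>i\<in>A. f i t)"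
proof (induction A rule: finite_induct)
  case empty
  show ?case using gap_null_cmult[OF gap_null_power[of 0], of 0] by simp
qed (auto intro!: gap_null_add)

text \<open>The polynomial has no constant term, so it is a linear combination of the positive
  powers already treated.\<close>

lemma gap_null_poly:
  assumes "real_polynomial_function q"
  shows "gap_null (\<lambda>t. t + t * (1 - t) * q t)"
proof -
  obtain b m where q: "q = (\<lambda>t. \<Sum>i\<le>m. b i * t ^ i)"
    using assms unfolding real_polynomial_function_iff_sum by blast
  have "gap_null (\<lambda>t. t ^ Suc 0 + (\<Sum>i\<le>m. b i * (t ^ Suc i + (- 1) * t ^ Suc (Suc i))))"
    by (intro gap_null_add gap_null_sum gap_null_cmult gap_null_power) auto
  also have "(\<lambda>t. t ^ Suc 0 + (\<Sum>i\<le>m. b i * (t ^ Suc i + (- 1) * t ^ Suc (Suc i)))) =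
      (\<lambda>t. t + t * (1 - t) * q t)"
    unfolding q sum_distrib_left by (auto intro!: ext sum.cong simp: algebra_simps)
  finally show ?thesis .
qed

text \<open>Karamata's argument: \<open>cutoff\<close> lies between polynomials \<open>t + t (1 - t) q\<^sub>i(t)\<close> for which the
  gap vanishes in the limit, and the nonnegativity of the weights makes the error depend only on the
  harmonic weights, where it is at most \<open>\<integral> (q\<^sub>2 - q\<^sub>1)\<close>.\<close>
lemma cutoff_gap_limit: "((\<lambda>s. exp_sum w u cutoff s - harmonic_sum cutoff s) \<longlongrightarrow> 0) (at_right 0)"
proof (rule tendstoI)
  fix e :: real assume e: "e > 0"
  obtain q1 q2 where q: "real_polynomial_function q1" "real_polynomial_function q2"
    "\<And>t. t \<in> {0..1} \<Longrightarrow> q1 t \<le> karamata_fn t" "\<And>t. t \<in> {0..1} \<Longrightarrow> karamata_fn t \<le> q2 t"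
    and int: "integral {0..1} (\<lambda>t. q2 t - q1 t) \<le> e / 4"
    using karamata_sandwich[of "e / 4"] e by auto
  define P1 where "P1 = (\<lambda>t. t + t * (1 - t) * q1 t)"
  define P2 where "P2 = (\<lambda>t. t + t * (1 - t) * q2 t)"
  have null: "gap_null P1" "gap_null P2" unfolding P1_def P2_def by (intro gap_null_poly q)+
  then have lin: "lin_bounded P1" "lin_bounded P2" by (auto simp: gap_null_def)
  have P: "P1 t \<le> cutoff t" "cutoff t \<le> P2 t" if "t \<in> {0..1}" for t
    using q(3,4)[OF that] that unfolding cutoff_eq P1_def P2_def
    by (auto intro!: mult_left_mono)
  have "real_polynomial_function (\<lambda>t. q2 t - q1 t)"
    using q(1,2) by (intro real_polynomial_function_diff)
  moreover have "0 \<le> q2 t - q1 t" if "t \<in> {0..1}" for t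
    using q(3,4)[OF that] by simp
  ultimately have ev: "\<forall>\<^sub>F s in at_right 0. harmonic_sum (\<lambda>t. t * (1 - t) * (q2 t - q1 t)) s < e / 2"
    using int e by (intro harmonic_sum_eventually_le) auto
  have "\<forall>\<^sub>F s in at_right 0. dist (exp_sum w u P1 s - harmonic_sum P1 s) 0 < e / 2"
    "\<forall>\<^sub>F s in at_right 0. dist (exp_sum w u P2 s - harmonic_sum P2 s) 0 < e / 2"
    using tendstoD[OF conjunct2[OF null(1)[unfolded gap_null_def]] half_gt_zero[OF e]]
      tendstoD[OF conjunct2[OF null(2)[unfolded gap_null_def]] half_gt_zero[OF e]] by simp_all
  with ev eventually_at_right_less
  show "\<forall>\<^sub>F s in at_right 0. dist (exp_sum w u cutoff s - harmonic_sum cutoff s) 0 < e"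
  proof eventually_elim
    case (elim s)
    have "(\<lambda>t. t * (1 - t) * (q2 t - q1 t)) = (\<lambda>t. P2 t + (- 1) * P1 t)"
      by (auto simp: P1_def P2_def algebra_simps)
    then have "harmonic_sum (\<lambda>t. t * (1 - t) * (q2 t - q1 t)) s = harmonic_sum P2 s - harmonic_sum P1 s"
      using elim lin by (simp only: harmonic.exp_sum_add harmonic.exp_sum_cmult lin_bounded_cmult)
    \<comment> \<open>By these four inequalities the gap of \<open>cutoff\<close> is at most that of
      \<open>P2\<close> plus the harmonic sum of \<open>P2 - P1\<close>, and at least that of
      \<open>P1\<close> minus the same sum. Each contribution is below \<open>e / 2\<close> in
      absolute value.\<close>
    moreover have "exp_sum w u P1 s \<le> exp_sum w u cutoff s" "exp_sum w u cutoff s \<le> exp_sum w u P2 s"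
      "harmonic_sum P1 s \<le> harmonic_sum cutoff s" "harmonic_sum cutoff s \<le> harmonic_sum P2 s"
      using elim lin P lin_bounded_cutoff by (auto intro!: exp_sum_mono harmonic.exp_sum_mono)
    ultimately show ?case using elim unfolding dist_real_def by linarith
  qed
qed

end

text \<open>At \<open>s = 1 / x\<close> the cutoff is the indicator of \<open>u n \<le> x\<close>.
  The alternative \<open>w n = 0\<close> allows the harmonic index 0, whose weight is 0, to stay
  outside \<open>A\<close>.\<close>

lemma exp_sum_cutoff:
  assumes x: "x > 0" and fin: "finite A"
    and A: "\<And>n. n \<in> A \<Longrightarrow> u n \<le> x" "\<And>n. n \<notin> A \<Longrightarrow> x < u n \<or> w n = 0"
  shows "exp_sum w u cutoff (1 / x) = (\<Sum>n\<in>A. w n)"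
proof -
  have c: "cutoff (exp (- (1 / x * u n))) = (if u n \<le> x then 1 else 0)" for n
    using x by (auto simp: cutoff_def field_simps)
  have "(\<Sum>n. w n * cutoff (exp (- (1 / x * u n)))) = (\<Sum>n\<in>A. w n * cutoff (exp (- (1 / x * u n))))"
    using A(2) unfolding c by (intro suminf_finite fin) force
  also have "\<dots> = (\<Sum>n\<in>A. w n)" using A(1) unfolding c by (intro sum.cong refl) simp
  finally show ?thesis by (simp add: exp_sum_def)
qed

section \<open>Mertens' third theorem\<close>

interpretation mertens: tauberian mertens_weight "\<lambda>n. ln (real n)"
proof
  show "0 \<le> ln (real n)" for n by (cases "n = 0") auto
qed (use mertens_weight_nonneg summable_mertens_weight(1) mertens_weight_abel_limit in auto)

text \<open>At \<open>s = 1 / ln m\<close> the cutoff selects the indices up to \<open>m\<close> on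
  one side and those up to the floor of \<open>ln m\<close> on the other. The latter give a harmonic
  number, which supplies Euler's constant.\<close>

lemma sum_mertens_weight_limit:
  "(\<lambda>m. (\<Sum>i\<le>m. mertens_weight i) - ln (ln (real m))) \<longlonglongrightarrow> euler_mascheroni"
proof -
  let ?N = "\<lambda>m::nat. nat \<lfloor>ln (real m)\<rfloor>"
  have "filterlim (\<lambda>m. 1 / ln (real m)) (at_right 0) sequentially" by real_asymp
  from filterlim_compose[OF mertens.cutoff_gap_limit this]
  have "(\<lambda>m. exp_sum mertens_weight (\<lambda>n. ln (real n)) cutoff (1 / ln (real m))
          - harmonic_sum cutoff (1 / ln (real m))) \<longlonglongrightarrow> 0" .
  moreover have "\<forall>\<^sub>F m in sequentially.
      exp_sum mertens_weight (\<lambda>n. ln (real n)) cutoff (1 / ln (real m))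
          - harmonic_sum cutoff (1 / ln (real m)) = (\<Sum>i\<le>m. mertens_weight i) - harm (?N m)"
    using eventually_ge_at_top[of 2]
  proof eventually_elim
    case (elim m)
    then have m: "ln (real m) > 0" by simp
    have "exp_sum mertens_weight (\<lambda>n. ln (real n)) cutoff (1 / ln (real m)) = (\<Sum>i\<le>m. mertens_weight i)"
    proof (rule exp_sum_cutoff[OF m])
      fix n assume "n \<in> {..m}"
      then show "ln (real n) \<le> ln (real m)" using elim m by (cases "n = 0") auto
    qed (use elim in auto)
    moreover have "harmonic_sum cutoff (1 / ln (real m)) = (\<Sum>i\<in>{1..?N m}. 1 / real i)"
    proof (rule exp_sum_cutoff[OF m])
      fix n assume "n \<in> {1..?N m}"
      then show "real n \<le> ln (real m)" using m by (auto simp: le_nat_floor le_nat_iff le_floor_iff)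
    next
      fix n assume "n \<notin> {1..?N m}"
      then show "ln (real m) < real n \<or> 1 / real n = 0"
        using m by (auto simp: not_le le_nat_iff le_floor_iff)
    qed auto
    ultimately show ?case by (simp add: harm_def inverse_eq_divide)
  qed
  ultimately have 1: "(\<lambda>m. (\<Sum>i\<le>m. mertens_weight i) - harm (?N m)) \<longlonglongrightarrow> 0"
    by (rule Lim_transform_eventually)
  have "filterlim ?N at_top sequentially"
    by (intro filterlim_compose[OF filterlim_nat_sequentially]
              filterlim_compose[OF filterlim_floor_sequentially]) real_asymp
  from filterlim_compose[OF euler_mascheroni_LIMSEQ this]
  have 2: "(\<lambda>m. harm (?N m) - ln (real (?N m))) \<longlonglongrightarrow> euler_mascheroni" .
  \<comment> \<open>Rounding \<open>ln m\<close> down costs only \<open>o(1)\<close> after taking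
    the logarithm.\<close>
  have "(\<lambda>m. ln (real_of_int \<lfloor>ln (real m)\<rfloor>) - ln (ln (real m))) \<longlonglongrightarrow> 0" by real_asymp
  moreover have "\<forall>\<^sub>F m in sequentially. ln (real_of_int \<lfloor>ln (real m)\<rfloor>) - ln (ln (real m))
      = ln (real (?N m)) - ln (ln (real m))"
    using eventually_ge_at_top[of 1] by eventually_elim simp
  ultimately have 3: "(\<lambda>m. ln (real (?N m)) - ln (ln (real m))) \<longlonglongrightarrow> 0"
    by (rule Lim_transform_eventually)
  from tendsto_add[OF tendsto_add[OF 1 2] 3] show ?thesis by simp
qed

theorem mertens_third:
  "(\<lambda>m. (\<Prod>i\<le>m. if prime i then 1 - 1 / real i else 1) * ln (real m)) \<longlonglongrightarrow> exp (- euler_mascheroni)"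
proof -
  have "(\<lambda>m. exp (- ((\<Sum>i\<le>m. mertens_weight i) - ln (ln (real m))))) \<longlonglongrightarrow> exp (- euler_mascheroni)"
    by (intro tendsto_intros sum_mertens_weight_limit)
  moreover have "\<forall>\<^sub>F m in sequentially. exp (- ((\<Sum>i\<le>m. mertens_weight i) - ln (ln (real m)))) =
      (\<Prod>i\<le>m. if prime i then 1 - 1 / real i else 1) * ln (real m)"
    using eventually_ge_at_top[of 2]
  proof eventually_elim
    case (elim m)
    have "exp (- (\<Sum>i\<le>m. mertens_weight i)) = (\<Prod>i\<le>m. exp (- mertens_weight i))"
      by (simp add: sum_negf[symmetric] exp_sum)
    also have "\<dots> = (\<Prod>i\<le>m. if prime i then 1 - 1 / real i else 1)"
      by (intro prod.cong refl) (auto simp: mertens_weight_def dest: prime_gt_1_nat)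
    finally show ?case using elim by (simp add: exp_diff exp_minus divide_inverse mult.commute)
  qed
  ultimately show ?thesis by (rule Lim_transform_eventually)
qed

section \<open>Regular residues\<close>

lemma regular_mod_coprime: "coprime a (int n) \<Longrightarrow> regular_mod n a"
proof -
  assume "coprime a (int n)"
  then obtain x where "[a * x = 1] (mod int n)" using cong_solve_coprime_int by blast
  then have "[a * (a * x) = a * 1] (mod int n)" by (rule cong_scalar_left)
  then show ?thesis by (auto simp: regular_mod_def power2_eq_square mult.assoc)
qed

lemma totient_le_varrho: "totient n \<le> varrho n"
proof -
  have "card (int ` totatives n) \<le> card {a \<in> {1..int n}. regular_mod n a}"
    by (intro card_mono finite_subset[of "{a \<in> {1..int n}. regular_mod n a}" "{1..int n}"])
       (auto simp: totatives_def intro!: regular_mod_coprime)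
  then show ?thesis by (simp add: varrho_def totient_def card_image)
qed

text \<open>The number \<open>p^k\<close> divides \<open>a * (a * x - 1)\<close>, and
  \<open>p\<close> cannot divide the second factor because it divides \<open>a\<close>; so the whole
  power falls on \<open>a\<close>.\<close>

lemma regular_mod_prime_power_dvd:
  assumes "regular_mod n a" "prime p" "int p dvd a" "p ^ k dvd n"
  shows "int (p ^ k) dvd a"
proof -
  from assms(1) obtain x where "[a\<^sup>2 * x = a] (mod int n)" by (auto simp: regular_mod_def)
  then have "int n dvd a\<^sup>2 * x - a" by (simp add: cong_iff_dvd_diff)
  moreover have "int (p ^ k) dvd int n" using assms(4) by (subst int_dvd_int_iff)
  ultimately have "int (p ^ k) dvd a\<^sup>2 * x - a" by (rule dvd_trans[rotated])
  then have d: "int (p ^ k) dvd a * (a * x - 1)" by (simp add: power2_eq_square algebra_simps)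
  have "coprime (int p) (a * x - 1)"
  proof (rule prime_imp_coprime)
    show "\<not> int p dvd a * x - 1"
    proof
      assume "int p dvd a * x - 1"
      moreover have "int p dvd a * x" using assms(3) by simp
      ultimately have "int p dvd int 1"
        using dvd_diff[of "int p" "a * x" "a * x - 1"] by simp
      then have "p dvd 1" by (simp only: int_dvd_int_iff)
      then show False using assms(2) by auto
    qed
  qed (use assms(2) in simp)
  then have "coprime (int (p ^ k)) (a * x - 1)" by simp
  with d show ?thesis by (simp add: coprime_dvd_mult_left_iff)
qed

lemma card_multiples_le: "d > 0 \<Longrightarrow> card {a \<in> {1..int n}. int d dvd a} \<le> n div d"
proof -
  assume d: "d > 0"
  have "{a \<in> {1..int n}. int d dvd a} \<subseteq> (*) (int d) ` {1..int (n div d)}"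
  proof
    fix a assume "a \<in> {a \<in> {1..int n}. int d dvd a}"
    then obtain b where b: "a = int d * b" and a: "1 \<le> a" "a \<le> int n" by auto
    have "0 < int d * b" using a b by simp
    then have "b > 0" using d by (simp add: zero_less_mult_iff)
    moreover have "b \<le> int n div int d"
      using a b d zdiv_mono1[of a "int n" "int d"] by simp
    ultimately show "a \<in> (*) (int d) ` {1..int (n div d)}" unfolding b by (auto simp: zdiv_int)
  qed
  then have "card {a \<in> {1..int n}. int d dvd a} \<le> card ((*) (int d) ` {1..int (n div d)})"
    by (intro card_mono) auto
  also have "\<dots> \<le> n div d" by (rule order_trans[OF card_image_le]) auto
  finally show ?thesis .
qed

text \<open>A regular residue not coprime to \<open>n\<close> shares a prime \<open>p\<close> with
  \<open>n\<close> and is then a multiple of \<open>p^k\<close>. For each of the at most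
  \<open>m\<close> such primes there are at most \<open>n / p^k \<le> n / 2^k\<close>
  multiples.\<close>

lemma varrho_le_totient_add:
  assumes n: "n > 0" and k: "\<And>p. prime p \<Longrightarrow> p dvd n \<Longrightarrow> p \<le> m \<and> p ^ k dvd n"
  shows "real (varrho n) \<le> real (totient n) + real m * (real n / 2 ^ k)"
proof -
  let ?P = "prime_factors n"
  let ?D = "\<lambda>p. {a \<in> {1..int n}. int (p ^ k) dvd a}"
  have sub: "{a \<in> {1..int n}. regular_mod n a} \<subseteq> int ` totatives n \<union> (\<Union>p\<in>?P. ?D p)"
  proof
    fix a assume a: "a \<in> {a \<in> {1..int n}. regular_mod n a}"
    then obtain b where b: "a = int b" using zero_le_imp_eq_int[of a] by auto
    show "a \<in> int ` totatives n \<union> (\<Union>p\<in>?P. ?D p)"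
    proof (cases "coprime b n")
      case True
      with a b have "b \<in> totatives n" by (auto simp: totatives_def)
      with b show ?thesis by blast
    next
      case False
      then have "gcd b n \<noteq> 1" using coprime_iff_gcd_eq_1 by blast
      then obtain p where p: "prime p" "p dvd gcd b n" using prime_factor_nat by blast
      then have p': "p dvd b" "p dvd n" by auto
      have "int p dvd a" using p' b by simp
      moreover have "regular_mod n a" using a by simp
      ultimately have "int (p ^ k) dvd a" using p p' k regular_mod_prime_power_dvd by blast
      with a have "a \<in> ?D p" by blast
      moreover have "p \<in> ?P" using p p' n by (auto simp: prime_factors_dvd)
      ultimately show ?thesis by blast
    qed
  qed
  have cardP: "card ?P \<le> m"
  proof -
    have "?P \<subseteq> {1..m}" using k prime_gt_0_nat n by (auto simp: prime_factors_dvd Suc_le_eq)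
    then have "card ?P \<le> card {1..m}" by (intro card_mono) auto
    then show ?thesis by simp
  qed
  have "varrho n \<le> card (int ` totatives n \<union> (\<Union>p\<in>?P. ?D p))"
    unfolding varrho_def
    by (intro card_mono sub finite_UnI finite_UN_I finite_imageI
          finite_subset[of "{a \<in> {1..int n}. int (p ^ k) dvd a}" "{1..int n}" for p]) auto
  also have "\<dots> \<le> card (int ` totatives n) + (\<Sum>p\<in>?P. card (?D p))"
    by (intro order_trans[OF card_Un_le] add_mono card_UN_le order_refl) auto
  finally have "real (varrho n) \<le> real (totient n) + (\<Sum>p\<in>?P. real (card (?D p)))"
    by (simp add: totient_def card_image flip: of_nat_sum of_nat_add)
  also have "(\<Sum>p\<in>?P. real (card (?D p))) \<le> (\<Sum>p\<in>?P. real n / 2 ^ k)"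
  proof (rule sum_mono)
    fix p assume "p \<in> ?P"
    then have p: "p \<ge> 2" using prime_ge_2_nat by auto
    have "real (card (?D p)) \<le> real (n div p ^ k)"
      using card_multiples_le[of "p ^ k" n] p by simp
    also have "\<dots> \<le> real n / real (p ^ k)" by (rule of_nat_div_le_of_nat)
    also have "\<dots> \<le> real n / 2 ^ k"
      using p by (intro divide_left_mono) (auto intro!: power_mono)
    finally show "real (card (?D p)) \<le> real n / 2 ^ k" .
  qed
  also have "\<dots> \<le> real m * (real n / 2 ^ k)" using cardP by (auto intro!: mult_right_mono simp del: times_divide_eq_right)
  finally show ?thesis by simp
qed

section \<open>Lower bound through the totient\<close>

lemma prod_primes_eq:
  "(\<Prod>i\<le>m. if prime i then 1 - 1 / real i else 1) = (\<Prod>p | prime p \<and> p \<le> m. 1 - 1 / real p)"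
  by (subst prod.inter_filter[symmetric]) (auto intro!: prod.cong)

text \<open>At most \<open>ln n / ln (ln n)\<close> primes exceeding \<open>ln n\<close> divide \<open>n\<close>, so their factors do not
  affect the product asymptotically.\<close>
lemma totient_lower_bound:
  assumes "ln (real n) > 1"
  shows "(\<Prod>i\<le>nat \<lfloor>ln (real n)\<rfloor>. if prime i then 1 - 1 / real i else 1) * (1 - 1 / ln (ln (real n)))
           \<le> real (totient n) / real n"
proof -
  define y where "y = ln (real n)"
  define m where "m = nat \<lfloor>y\<rfloor>"
  have y: "y > 1" using assms by (simp add: y_def)
  have n: "n > 0" using y by (cases "n = 0") (auto simp: y_def)
  define B where "B = {p \<in> prime_factors n. p > m}"
  define A where "A = {p \<in> prime_factors n. p \<le> m}"
  have pos: "0 < 1 - 1 / real p" "1 - 1 / real p \<le> 1" if "prime p" for p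
    using prime_gt_1_nat[OF that] by auto
  \<comment> \<open>Including the primes up to \<open>m\<close> that do not divide \<open>n\<close>
    only shrinks the product.\<close>
  have A: "(\<Prod>p | prime p \<and> p \<le> m. 1 - 1 / real p) \<le> (\<Prod>p\<in>A. 1 - 1 / real p)"
  proof -
    let ?S = "{p. prime p \<and> p \<le> m}"
    have "(\<Prod>p\<in>?S. 1 - 1 / real p) = (\<Prod>p\<in>?S - A. 1 - 1 / real p) * (\<Prod>p\<in>A. 1 - 1 / real p)"
      by (rule prod.subset_diff) (auto simp: A_def)
    also have "\<dots> \<le> 1 * (\<Prod>p\<in>A. 1 - 1 / real p)"
      using pos by (intro mult_right_mono prod_nonneg prod_le_1) (auto simp: A_def intro: less_imp_le)
    finally show ?thesis by simp
  qed
  have By: "y < real p" if "p \<in> B" for p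
    using that y unfolding B_def m_def by (auto simp: nat_less_iff floor_less_iff)
  \<comment> \<open>The product of the large prime divisors divides \<open>n\<close>. Each of them
    exceeds \<open>y\<close>, so \<open>y ^ card B \<le> n = exp y\<close>, which bounds
    \<open>card B\<close> by \<open>y / ln y\<close>.\<close>
  have "\<Prod>B dvd (\<Prod>p\<in>B. p ^ multiplicity p n)"
    by (intro prod_dvd_prod) (auto simp: B_def prime_factors_multiplicity intro: dvd_power)
  also have "\<dots> dvd (\<Prod>p\<in>prime_factors n. p ^ multiplicity p n)"
    by (rule prod_dvd_prod_subset) (auto simp: B_def)
  also have "\<dots> = n" using prime_factorization_nat[of n] n by simp
  finally have dvd: "\<Prod>B dvd n" .
  have "y ^ card B = (\<Prod>p\<in>B. y)" by simp
  also have "\<dots> \<le> (\<Prod>p\<in>B. real p)" using By y by (intro prod_mono) (auto intro: less_imp_le)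
  also have "\<dots> = real (\<Prod>B)" by simp
  also have "\<dots> \<le> real n" using dvd n by (auto intro: dvd_imp_le simp del: of_nat_prod)
  finally have "ln (y ^ card B) \<le> ln (real n)" using y n by (subst ln_le_cancel_iff) auto
  then have cB: "real (card B) * ln y \<le> y" using y by (simp add: ln_realpow y_def)
  have "real (card B) / y \<le> 1 / ln y" using cB y by (simp add: field_simps)
  then have "1 - 1 / ln y \<le> 1 + real (card B) * (- (1 / y))" by simp
  also have "\<dots> \<le> (1 + - (1 / y)) ^ card B"
    by (rule Bernoulli_inequality) (use y in auto)
  also have "\<dots> = (\<Prod>p\<in>B. 1 - 1 / y)" by simp
  also have "\<dots> \<le> (\<Prod>p\<in>B. 1 - 1 / real p)"
    using By y by (intro prod_mono conjI diff_left_mono frac_le) (auto intro: less_imp_le)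
  finally have B: "1 - 1 / ln y \<le> (\<Prod>p\<in>B. 1 - 1 / real p)" .
  have "(\<Prod>p | prime p \<and> p \<le> m. 1 - 1 / real p) * (1 - 1 / ln y) \<le>
      (\<Prod>p | prime p \<and> p \<le> m. 1 - 1 / real p) * (\<Prod>p\<in>B. 1 - 1 / real p)"
    using B pos by (intro mult_left_mono prod_nonneg) (auto intro: less_imp_le)
  also have "\<dots> \<le> (\<Prod>p\<in>A. 1 - 1 / real p) * (\<Prod>p\<in>B. 1 - 1 / real p)"
    using A pos by (intro mult_right_mono prod_nonneg) (auto simp: B_def intro: less_imp_le)
  also have "\<dots> = (\<Prod>p\<in>A \<union> B. 1 - 1 / real p)"
    by (rule prod.union_disjoint[symmetric]) (auto simp: A_def B_def)
  also have "A \<union> B = prime_factors n" by (auto simp: A_def B_def)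
  also have "(\<Prod>p\<in>prime_factors n. 1 - 1 / real p) = real (totient n) / real n"
    using n by (simp add: totient_formula2)
  finally show ?thesis unfolding prod_primes_eq y_def m_def .
qed

text \<open>The minorant is Mertens' product at the floor of \<open>ln n\<close>, times the
  logarithm of that floor and a factor tending to 1. Using the floor in place of \<open>ln n\<close>
  inside the logarithm only lowers it.\<close>

lemma varrho_lower_limit:
  "\<exists>g. g \<longlonglongrightarrow> exp (- euler_mascheroni :: real) \<and>
     (\<forall>\<^sub>F n in sequentially. g n \<le> real (varrho n) * ln (ln (real n)) / real n)"
proof (intro exI conjI)
  let ?m = "\<lambda>n::nat. nat \<lfloor>ln (real n)\<rfloor>"
  let ?M = "\<lambda>m. \<Prod>i\<le>m. if prime i then 1 - 1 / real i else (1::real)"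
  let ?g = "\<lambda>n. ?M (?m n) * ln (real (?m n)) * (1 - 1 / ln (ln (real n)))"
  have "filterlim ?m at_top sequentially"
    by (intro filterlim_compose[OF filterlim_nat_sequentially]
              filterlim_compose[OF filterlim_floor_sequentially]) real_asymp
  from filterlim_compose[OF mertens_third this]
  have "(\<lambda>n. ?M (?m n) * ln (real (?m n))) \<longlonglongrightarrow> exp (- euler_mascheroni)" .
  moreover have "(\<lambda>n. 1 - 1 / ln (ln (real n))) \<longlonglongrightarrow> 1" by real_asymp
  ultimately show "?g \<longlonglongrightarrow> exp (- euler_mascheroni)"
    using tendsto_mult by fastforce
  have "\<forall>\<^sub>F n in sequentially. ln (ln (real n)) > 1" by real_asymp
  moreover have "\<forall>\<^sub>F n in sequentially. ln (real n) > 1" by real_asymp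
  ultimately show "\<forall>\<^sub>F n in sequentially. ?g n \<le> real (varrho n) * ln (ln (real n)) / real n"
    using eventually_gt_at_top[of 0]
  proof eventually_elim
    case (elim n)
    have M: "?M (?m n) \<ge> 0" by (intro prod_nonneg) (auto dest: prime_gt_1_nat)
    have "real (?m n) \<le> ln (real n)" "real (?m n) > 0" using elim by (auto simp: le_floor_iff)
    then have "ln (real (?m n)) \<le> ln (ln (real n))" by (subst ln_le_cancel_iff) linarith+
    moreover have "0 \<le> 1 - 1 / ln (ln (real n))" using elim by simp
    ultimately have "?g n \<le> ?M (?m n) * (1 - 1 / ln (ln (real n))) * ln (ln (real n))"
      using mult_right_mono[of "ln (real (?m n))" "ln (ln (real n))" "?M (?m n) * (1 - 1 / ln (ln (real n)))"] M
      by (simp only: mult_nonneg_nonneg) (simp only: mult_ac)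
    also have "\<dots> \<le> real (totient n) / real n * ln (ln (real n))"
      using elim by (intro mult_right_mono totient_lower_bound) auto
    also have "\<dots> \<le> real (varrho n) / real n * ln (ln (real n))"
      using elim totient_le_varrho by (intro mult_right_mono divide_right_mono) auto
    finally show ?case by simp
  qed
qed

section \<open>Upper bound along an extremal sequence\<close>

text \<open>The exponent is large enough for the error \<open>m / 2\<^sup>k\<close> of \<open>varrho_le_totient_add\<close> to vanish
  (\<open>m = 2\<^sup>j\<close>, \<open>k = 2 j\<close>), yet so small that \<open>ln (ln (extremal j)) = ln m + O(ln j)\<close>.\<close>
definition extremal :: "nat \<Rightarrow> nat" where
  "extremal j = fact (2 ^ j) ^ (2 * j)"

lemma extremal_ge: "extremal j \<ge> j"
proof (cases "j = 0")
  case False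
  have "j \<le> 2 ^ j" by (simp add: less_imp_le)
  also have "\<dots> \<le> fact (2 ^ j)" by (rule fact_ge_self)
  also have "\<dots> \<le> extremal j" unfolding extremal_def using False by (intro self_le_power) (auto simp: Suc_le_eq)
  finally show ?thesis .
qed simp

text \<open>This follows from the crude bound \<open>fact m \<le> m^m\<close> at
  \<open>m = 2^j\<close>.\<close>

lemma ln_ln_extremal_le:
  assumes "j \<ge> 1"
  shows "ln (ln (real (extremal j))) \<le> ln (2 * real j ^ 2 * ln 2) + real j * ln 2"
proof -
  have "(1::nat) < fact (2 ^ j)"
  proof -
    have "(2::nat) \<le> 2 ^ j" using assms by (simp add: self_le_power)
    also have "\<dots> \<le> fact (2 ^ j)" by (rule fact_ge_self)
    finally show ?thesis by simp
  qed
  then have f: "1 < (fact (2 ^ j) :: real)" by (metis of_nat_1 of_nat_fact of_nat_less_iff)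
  have "ln (real (extremal j)) = 2 * real j * ln (fact (2 ^ j))"
    using f by (simp add: extremal_def ln_realpow)
  moreover have "ln (fact (2 ^ j) :: real) \<le> 2 ^ j * (real j * ln 2)"
  proof -
    have "(fact (2 ^ j) :: real) \<le> (2 ^ j) ^ (2 ^ j)" using fact_le_power[of "2 ^ j", where 'a=real] by simp
    then have "ln (fact (2 ^ j) :: real) \<le> ln ((2 ^ j) ^ (2 ^ j))" by (subst ln_le_cancel_iff) auto
    then show ?thesis by (simp add: ln_realpow)
  qed
  ultimately have "ln (real (extremal j)) \<le> 2 * real j * (2 ^ j * (real j * ln 2))"
    by (simp add: mult_left_mono)
  also have "\<dots> = (2 * real j ^ 2 * ln 2) * 2 ^ j" by (simp add: power2_eq_square)
  finally have "ln (real (extremal j)) \<le> (2 * real j ^ 2 * ln 2) * 2 ^ j" .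
  moreover have "0 < ln (real (extremal j))"
    using f assms \<open>ln (real (extremal j)) = _\<close> by simp
  ultimately have "ln (ln (real (extremal j))) \<le> ln ((2 * real j ^ 2 * ln 2) * 2 ^ j)"
    using assms by (subst ln_le_cancel_iff) auto
  also have "\<dots> = ln (2 * real j ^ 2 * ln 2) + real j * ln 2"
    using assms by (subst ln_mult_pos) (auto simp: ln_realpow)
  finally show ?thesis .
qed

text \<open>The primes dividing \<open>extremal j\<close> are exactly those up to
  \<open>2^j\<close>, so its totient quotient is the full Mertens product. Each occurs to a power of
  at least \<open>2 * j\<close>, which leaves the error \<open>2^j / 2^(2*j)\<close>.\<close>

lemma varrho_extremal_le:
  assumes "j \<ge> 1"
  shows "real (varrho (extremal j)) / real (extremal j) \<le>
           (\<Prod>i\<le>2 ^ j. if prime i then 1 - 1 / real i else 1) + 1 / 2 ^ j"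
proof -
  let ?n = "extremal j"
  have n: "?n > 0" by (simp add: extremal_def)
  have "p \<le> 2 ^ j \<and> p ^ (2 * j) dvd ?n" if p: "prime p" "p dvd ?n" for p
  proof -
    have "p dvd fact (2 ^ j)" using p prime_dvd_power unfolding extremal_def by blast
    then show ?thesis using p by (auto simp: extremal_def prime_dvd_fact_iff intro: dvd_power_same)
  qed
  from varrho_le_totient_add[OF n this]
  have "real (varrho ?n) \<le> real (totient ?n) + 2 ^ j * (real ?n / 2 ^ (2 * j))" by simp
  then have "real (varrho ?n) / real ?n \<le> (real (totient ?n) + 2 ^ j * (real ?n / 2 ^ (2 * j))) / real ?n"
    by (intro divide_right_mono) auto
  also have "\<dots> = real (totient ?n) / real ?n + 1 / 2 ^ j"
    using n by (simp add: add_divide_distrib mult_2 power_add)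
  also have "real (totient ?n) / real ?n = (\<Prod>p\<in>prime_factors ?n. 1 - 1 / real p)"
    using n by (simp add: totient_formula2)
  also have "prime_factors ?n = {p. prime p \<and> p \<le> 2 ^ j}"
  proof -
    have "prime_factors ?n = prime_factors (fact (2 ^ j))"
      unfolding extremal_def using assms by (subst prime_factors_power) auto
    then show ?thesis by (auto simp: prime_factors_fact dest: prime_ge_2_nat)
  qed
  finally show ?thesis unfolding prod_primes_eq .
qed

text \<open>The bound for the iterated logarithm is asymptotic to
  \<open>j * ln 2 = ln (2^j)\<close>, the factor in Mertens' theorem at \<open>2^j\<close>. Its
  product with the error \<open>1 / 2^j\<close> tends to 0.\<close>

lemma varrho_upper_limit:
  "\<exists>h. h \<longlonglongrightarrow> exp (- euler_mascheroni :: real) \<and>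
     (\<forall>\<^sub>F j in sequentially. real (varrho (extremal j)) * ln (ln (real (extremal j))) / real (extremal j) \<le> h j)"
proof (intro exI conjI)
  let ?M = "\<lambda>m. \<Prod>i\<le>m. if prime i then 1 - 1 / real i else (1::real)"
  let ?a = "\<lambda>j::nat. ln (2 * real j ^ 2 * ln 2) + real j * ln 2"
  let ?h = "\<lambda>j. (?M (2 ^ j) + 1 / 2 ^ j) * ?a j"
  have "filterlim (\<lambda>j. 2 ^ j :: nat) at_top sequentially"
    by (rule filterlim_at_top_mono[OF filterlim_ident]) (simp add: less_imp_le)
  from filterlim_compose[OF mertens_third this]
  have 1: "(\<lambda>j. ?M (2 ^ j) * (real j * ln 2)) \<longlonglongrightarrow> exp (- euler_mascheroni)"
    by (simp add: ln_realpow)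
  have 2: "(\<lambda>j. ?a j / (real j * ln 2)) \<longlonglongrightarrow> 1" by real_asymp
  have 3: "(\<lambda>j. 1 / 2 ^ j * ?a j) \<longlonglongrightarrow> 0" by real_asymp
  have "(\<lambda>j. ?M (2 ^ j) * (real j * ln 2) * (?a j / (real j * ln 2)) + 1 / 2 ^ j * ?a j)
      \<longlonglongrightarrow> exp (- euler_mascheroni) * 1 + 0"
    by (intro tendsto_add tendsto_mult 1 2 3)
  moreover have "\<forall>\<^sub>F j in sequentially.
      ?M (2 ^ j) * (real j * ln 2) * (?a j / (real j * ln 2)) + 1 / 2 ^ j * ?a j = ?h j"
    using eventually_gt_at_top[of 0] by eventually_elim (simp add: distrib_right)
  ultimately show "?h \<longlonglongrightarrow> exp (- euler_mascheroni)"
    using Lim_transform_eventually by fastforce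
  show "\<forall>\<^sub>F j in sequentially.
      real (varrho (extremal j)) * ln (ln (real (extremal j))) / real (extremal j) \<le> ?h j"
    using eventually_ge_at_top[of 1] eventually_ge_at_top[of "16::nat"]
  proof eventually_elim
    case (elim j)
    \<comment> \<open>The size 16 ensures that the logarithm is at least 1, hence that the iterated
      logarithm is nonnegative, as multiplying the inequalities requires.\<close>
    have "(16::real) \<le> real (extremal j)" using extremal_ge[of j] elim by linarith
    moreover have "ln (16::real) = 4 * ln 2" using ln_realpow[of 2 4] by simp
    ultimately have "1 \<le> ln (real (extremal j))"
      using ln_le_cancel_iff[of 16 "real (extremal j)"] ln2_ge_two_thirds by linarith
    then have l: "0 \<le> ln (ln (real (extremal j)))" by simp
    have "0 \<le> ?M (2 ^ j)" by (intro prod_nonneg) (auto dest: prime_gt_1_nat)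
    then have "real (varrho (extremal j)) / real (extremal j) * ln (ln (real (extremal j))) \<le> ?h j"
      using elim l by (intro mult_mono varrho_extremal_le ln_ln_extremal_le) auto
    then show ?case by simp
  qed
qed

theorem theorem7:
  shows "liminf (\<lambda>n. ereal (real (varrho n) * ln (ln (real n)) / real n))
           = ereal (exp (- (euler_mascheroni :: real)))"
proof (rule antisym)
  let ?f = "\<lambda>n. real (varrho n) * ln (ln (real n)) / real n"
  obtain g where g: "g \<longlonglongrightarrow> exp (- euler_mascheroni :: real)" "\<forall>\<^sub>F n in sequentially. g n \<le> ?f n"
    using varrho_lower_limit by blast
  obtain h where h: "h \<longlonglongrightarrow> exp (- euler_mascheroni :: real)" "\<forall>\<^sub>F j in sequentially. ?f (extremal j) \<le> h j"
    using varrho_upper_limit by blast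
  have "ereal (exp (- euler_mascheroni)) = liminf (\<lambda>n. ereal (g n))"
    using g(1) by (intro lim_imp_Liminf[symmetric]) auto
  also have "\<dots> \<le> liminf (\<lambda>n. ereal (?f n))" using g(2) by (intro Liminf_mono) simp
  finally show "ereal (exp (- euler_mascheroni)) \<le> liminf (\<lambda>n. ereal (?f n))" .
  have ext: "filterlim extremal at_top sequentially"
    by (rule filterlim_at_top_mono[OF filterlim_ident]) (simp add: extremal_ge)
  show "liminf (\<lambda>n. ereal (?f n)) \<le> ereal (exp (- euler_mascheroni))"
  \<comment> \<open>Any \<open>c\<close> below the liminf is eventually below the quotient, in
    particular along \<open>extremal\<close>, and hence does not exceed the limit of the majorant
    \<open>h\<close>.\<close>
  proof (rule dense_le)
    fix c assume "c < liminf (\<lambda>n. ereal (?f n))"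
    then have "\<forall>\<^sub>F n in sequentially. c < ereal (?f n)" by (rule less_LiminfD)
    from eventually_compose_filterlim[OF this ext] h(2)
    have "\<forall>\<^sub>F j in sequentially. c \<le> ereal (h j)"
      by eventually_elim (metis ereal_less_eq(3) less_imp_le order_trans)
    moreover have "(\<lambda>j. ereal (h j)) \<longlonglongrightarrow> ereal (exp (- euler_mascheroni))" using h(1) by simp
    ultimately show "c \<le> ereal (exp (- euler_mascheroni))"
      by (intro tendsto_lowerbound) auto
  qed
qed

end
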